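(* Let $(\mathcal{X},\le)$ be any finite poset and let $\ell:[0,1]\times[0,1]\to\mathbb{R}$ be an $L$-Lipschitz loss function. For any $\varepsilon\in(0,1]$, there is an $\varepsilon$-DP algorithm for isotonic regression over $\mathcal{X}$ for $\ell$ which, given $n$ input points, has expected excess empirical risk at most $$O\left(\frac{L\cdot \mathrm{width}(\mathcal{X})\cdot\log|\mathcal{X}|\cdot(1+\log^2(\varepsilon n))}{\varepsilon n}\right).$$
   Context: For a poset $(\mathcal{X},\le)$, $\mathcal{F}(\mathcal{X},[0,1])$ is the set of monotone functions $f:\mathcal{X}\to[0,1]$, i.e. $f(x)\le f(x')$ whenever $x\le x'$. The width $\mathrm{width}(\mathcal{X})$ is the maximum size of an anti-chain in $\mathcal{X}$, an anti-chain being a set of elements no two distinct of which are comparable. For a dataset $D=\{(x_1,y_1),\dots,(x_n,y_n)\}\in(\mathcal{X}\times[0,1])^n$ and $f:\mathcal{X}\to[0,1]$, the empirical risk is $\mathcal{L}(f;D)=\frac1n\sum_{i=1}^n\ell(f(x_i),y_i)$. The excess empirical risk of $f$ on $D$ is $\mathcal{L}(f;D)-\mathcal{L}(f^*;D)$, where $f^*$ minimizes $\mathcal{L}(\cdot;D)$ over $\mathcal{F}(\mathcal{X},[0,1])$. An algorithm for isotonic regression is a randomized map $\mathcal{M}$ from datasets in $(\mathcal{X}\times[0,1])^n$ to $\mathcal{F}(\mathcal{X},[0,1])$. Its expected excess empirical risk on $D$ is the expectation, over the randomness of $\mathcal{M}$, of the excess empirical risk of $\mathcal{M}(D)$; the bound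 holds for every dataset $D$ of size $n$, and $O(\cdot)$ hides an absolute constant. Two datasets of size $n$ are neighboring if there is an index $i$ such that they agree in all entries other than the $i$-th. A randomized algorithm $\mathcal{M}$ is $(\varepsilon,\delta)$-DP if $\Pr[\mathcal{M}(D)\in S]\le e^{\varepsilon}\Pr[\mathcal{M}(D')\in S]+\delta$ for all neighboring $D,D'$ and all measurable sets $S$ of outputs; $\varepsilon$-DP means $(\varepsilon,0)$-DP.
   Formalization: The factor log|X| is read as max(1, log_2|X|); this changes the bound only for a one-point poset, where log|X| = 0 and the literal bound of zero excess risk cannot be met by any ε-DP algorithm (e.g. absolute loss). *)

theory Defs
  imports "HOL-Probability.Probability"
begin

(* Posets are explicit carriers with a relation, not instances of the class order, so
   that a constant can be chosen before the poset. The finite subsets of an infinite type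
   already carry every finite poset up to isomorphism, so at such a type a constant
   uniform in X :: 'a set and r is an absolute one.

   Risk bounds with a factor log |X| use max 1 (log 2 |X|). This is log 2 |X| as soon as
   |X| >= 2. On a one-point poset log |X| = 0, while no pure DP algorithm has
   excess risk 0 for every dataset and loss, so there the factor is read as 1. *)

definition antichain_in :: "'a set \<Rightarrow> 'a rel \<Rightarrow> 'a set \<Rightarrow> bool" where
  "antichain_in X r A \<longleftrightarrow>
     A \<subseteq> X \<and> (\<forall>a\<in>A. \<forall>b\<in>A. a \<noteq> b \<longrightarrow> (a, b) \<notin> r \<and> (b, a) \<notin> r)"

(* Meaningful for finite X. *)
definition width :: "'a set \<Rightarrow> 'a rel \<Rightarrow> nat" where
  "width X r = Max (card ` {A. antichain_in X r A})"

(* A function on X is represented by its extensional extension, which makes functions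
   on X equal as soon as they agree on X. *)
definition isotonic_functions :: "'a set \<Rightarrow> 'a rel \<Rightarrow> ('a \<Rightarrow> real) set" where
  "isotonic_functions X r =
     {f \<in> X \<rightarrow>\<^sub>E {0..1}. monotone_on X (\<lambda>x x'. (x, x') \<in> r) (\<le>) f}"

definition isotonic_space :: "'a set \<Rightarrow> 'a rel \<Rightarrow> ('a \<Rightarrow> real) measure" where
  "isotonic_space X r = restrict_space (Pi\<^sub>M X (\<lambda>_. borel)) (isotonic_functions X r)"

definition datasets :: "'a set \<Rightarrow> nat \<Rightarrow> ('a \<times> real) list set" where
  "datasets X n = {D. length D = n \<and> set D \<subseteq> X \<times> {0..1}}"

definition neighboring :: "'b list \<Rightarrow> 'b list \<Rightarrow> bool" where
  "neighboring D D' \<longleftrightarrow> length D = length D' \<and>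
     (\<exists>i<length D. \<forall>j<length D. j \<noteq> i \<longrightarrow> D ! j = D' ! j)"

definition empirical_risk ::
    "(real \<Rightarrow> real \<Rightarrow> real) \<Rightarrow> ('a \<times> real) list \<Rightarrow> ('a \<Rightarrow> real) \<Rightarrow> real" where
  "empirical_risk \<l> D f =
     1 / real (length D) * (\<Sum>i<length D. \<l> (f (fst (D ! i))) (snd (D ! i)))"

(* The minimizer chosen by arg_min_on exists by empirical_risk_has_minimizer below. *)
definition excess_risk ::
    "'a set \<Rightarrow> 'a rel \<Rightarrow> (real \<Rightarrow> real \<Rightarrow> real) \<Rightarrow> ('a \<times> real) list \<Rightarrow> ('a \<Rightarrow> real) \<Rightarrow> real" where
  "excess_risk X r \<l> D f =
     empirical_risk \<l> D f
     - empirical_risk \<l> D (arg_min_on (empirical_risk \<l> D) (isotonic_functions X r))"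

(* A randomized map sends each input to the law of its output. *)
definition isotonic_algorithm ::
    "'a set \<Rightarrow> 'a rel \<Rightarrow> nat \<Rightarrow> (('a \<times> real) list \<Rightarrow> ('a \<Rightarrow> real) measure) \<Rightarrow> bool" where
  "isotonic_algorithm X r n M \<longleftrightarrow>
     M \<in> datasets X n \<rightarrow> space (prob_algebra (isotonic_space X r))"

definition isotonic_DP ::
    "'a set \<Rightarrow> 'a rel \<Rightarrow> nat \<Rightarrow> real \<Rightarrow> real
      \<Rightarrow> (('a \<times> real) list \<Rightarrow> ('a \<Rightarrow> real) measure) \<Rightarrow> bool" where
  "isotonic_DP X r n \<epsilon> \<delta> M \<longleftrightarrow>
     (\<forall>D\<in>datasets X n. \<forall>D'\<in>datasets X n. neighboring D D' \<longrightarrow>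
        (\<forall>S\<in>sets (isotonic_space X r). measure (M D) S \<le> exp \<epsilon> * measure (M D') S + \<delta>))"

(* Lipschitz continuity in the prediction only, uniformly in the label: this is implied
   by joint Lipschitz continuity on the unit square for the usual product metrics. *)
definition lipschitz_loss :: "real \<Rightarrow> (real \<Rightarrow> real \<Rightarrow> real) \<Rightarrow> bool" where
  "lipschitz_loss L \<l> \<longleftrightarrow> (\<forall>y\<in>{0..1}. L-lipschitz_on {0..1} (\<lambda>t. \<l> t y))"

lemma compact_isotonic_functions: "compact (isotonic_functions X r)"
proof -
  let ?B = "\<lambda>i. if i \<in> X then {0..1::real} else {undefined}"
  have eq: "isotonic_functions X r =
      PiE UNIV ?B \<inter> (\<Inter>p\<in>{p \<in> X \<times> X. p \<in> r}. {f. f (fst p) \<le> f (snd p)})"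
    by (auto simp: isotonic_functions_def monotone_on_def PiE_iff extensional_def
        split: if_splits; metis)
  have "compactin (product_topology (\<lambda>_. euclidean) UNIV) (PiE UNIV ?B)"
    by (subst compactin_PiE) auto
  then have "compact (PiE UNIV ?B)"
    by (simp add: euclidean_product_topology)
  moreover have "closed {f :: 'a \<Rightarrow> real. f x \<le> f y}" for x y
    by (intro closed_Collect_le continuous_on_product_coordinates)
  ultimately show ?thesis
    unfolding eq by (intro compact_Int_closed closed_INT) auto
qed

lemma isotonic_functions_nonempty: "isotonic_functions X r \<noteq> {}"
proof -
  have "restrict (\<lambda>_. 0) X \<in> isotonic_functions X r"
    by (auto simp: isotonic_functions_def monotone_on_def)
  then show ?thesis by blast
qed

lemma continuous_on_empirical_risk:
  assumes "lipschitz_loss L \<l>" "D \<in> datasets X n"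
  shows "continuous_on (isotonic_functions X r) (empirical_risk \<l> D)"
proof -
  have "continuous_on (isotonic_functions X r) (\<lambda>f. \<l> (f (fst (D ! i))) (snd (D ! i)))"
    if i: "i < length D" for i
  proof -
    have D: "fst (D ! i) \<in> X" "snd (D ! i) \<in> {0..1}"
      using assms(2) nth_mem[OF i] by (auto simp: datasets_def)
    have "continuous_on {0..1} (\<lambda>t. \<l> t (snd (D ! i)))"
      using assms(1) D(2) unfolding lipschitz_loss_def by (blast intro: lipschitz_on_continuous_on)
    then show ?thesis
    proof (rule continuous_on_compose2)
      show "continuous_on (isotonic_functions X r) (\<lambda>f. f (fst (D ! i)))"
        by (rule continuous_on_subset[OF continuous_on_product_coordinates]) simp
      show "(\<lambda>f. f (fst (D ! i))) ` isotonic_functions X r \<subseteq> {0..1}"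
        using D(1) by (auto simp: isotonic_functions_def PiE_iff)
    qed
  qed
  then show ?thesis
    unfolding empirical_risk_def by (intro continuous_intros) auto
qed

lemma empirical_risk_has_minimizer:
  assumes "lipschitz_loss L \<l>" "D \<in> datasets X n"
  shows "is_arg_min (empirical_risk \<l> D) (\<lambda>f. f \<in> isotonic_functions X r)
           (arg_min_on (empirical_risk \<l> D) (isotonic_functions X r))"
proof -
  have "\<exists>f\<in>isotonic_functions X r. \<forall>g\<in>isotonic_functions X r.
      empirical_risk \<l> D f \<le> empirical_risk \<l> D g"
    by (rule continuous_attains_inf[OF compact_isotonic_functions isotonic_functions_nonempty
          continuous_on_empirical_risk[OF assms]])
  then have "\<exists>f. is_arg_min (empirical_risk \<l> D) (\<lambda>f. f \<in> isotonic_functions X r) f"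
    by (auto simp: is_arg_min_linorder)
  then show ?thesis
    unfolding arg_min_on_def arg_min_def by (rule someI_ex)
qed

lemma integrable_excess_risk:
  assumes "lipschitz_loss L \<l>" "D \<in> datasets X n"
    and N: "N \<in> space (prob_algebra (isotonic_space X r))"
  shows "integrable N (excess_risk X r \<l> D)"
proof -
  let ?F = "isotonic_functions X r"
  interpret N: prob_space N using N by (simp add: space_prob_algebra)
  have sN: "sets N = sets (isotonic_space X r)" using N by (simp add: space_prob_algebra)
  have sub: "?F \<subseteq> space (Pi\<^sub>M X (\<lambda>_. borel))"
    by (auto simp: isotonic_functions_def space_PiM PiE_iff extensional_def)
  have spI: "space (isotonic_space X r) = ?F"
    using sub by (auto simp: isotonic_space_def space_restrict_space)
  then have spN: "space N = ?F" using sets_eq_imp_space_eq[OF sN] by simp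
  have "(\<lambda>f. \<l> (f (fst (D ! i))) (snd (D ! i))) \<in> borel_measurable (isotonic_space X r)"
    if i: "i < length D" for i
  proof -
    have D: "fst (D ! i) \<in> X" "snd (D ! i) \<in> {0..1}"
      using assms(2) nth_mem[OF i] by (auto simp: datasets_def)
    have c: "continuous_on {0..1} (\<lambda>t. \<l> t (snd (D ! i)))"
      using assms(1) D(2) unfolding lipschitz_loss_def by (blast intro: lipschitz_on_continuous_on)
    have "(\<lambda>f. f (fst (D ! i))) \<in> borel_measurable (isotonic_space X r)"
      unfolding isotonic_space_def
      by (intro measurable_restrict_space1 measurable_component_singleton D)
    then have "(\<lambda>f. f (fst (D ! i))) \<in> isotonic_space X r \<rightarrow>\<^sub>M restrict_space borel {0..1}"
      using D(1) by (intro measurable_restrict_space2)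
        (auto simp: spI isotonic_functions_def PiE_iff)
    from measurable_compose[OF this borel_measurable_continuous_on_restrict[OF c]]
    show ?thesis .
  qed
  then have "excess_risk X r \<l> D \<in> borel_measurable (isotonic_space X r)"
    unfolding excess_risk_def empirical_risk_def by (intro borel_measurable_diff borel_measurable_times
        borel_measurable_sum borel_measurable_const) auto
  then have meas: "excess_risk X r \<l> D \<in> borel_measurable N"
    using measurable_cong_sets[OF sN refl] by blast
  have "continuous_on ?F (excess_risk X r \<l> D)"
    unfolding excess_risk_def
    by (intro continuous_intros continuous_on_empirical_risk[OF assms(1,2)])
  then have "bounded (excess_risk X r \<l> D ` ?F)"
    by (intro compact_imp_bounded compact_continuous_image compact_isotonic_functions)
  then obtain B where "\<And>f. f \<in> ?F \<Longrightarrow> norm (excess_risk X r \<l> D f) \<le> B"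
    unfolding bounded_iff by blast
  then show ?thesis
    by (intro N.integrable_const_bound[where B = B] meas AE_I2) (auto simp: spN)
qed

end

theory Submission
  imports Defs
begin

text \<open>Predictions are determined bit by bit: after \<open>t\<close> rounds the state assigns to every point a
  dyadic interval of length \<open>2 ^ -t\<close>, monotonically, and each round halves all intervals at once by
  one exponential mechanism whose score of a refinement is the least loss of a monotone grid function
  inside it. Inside an interval of length \<open>2 ^ -t\<close> the loss varies by at most \<open>L * 2 ^ -t\<close>, so up to an
  additive constant the score has sensitivity of that order, while a state at level \<open>t\<close> has only
  \<open>(card X + 1) ^ (width X r * 2 ^ t)\<close> refinements. Hence every round costs
  \<open>O(L T * width X r * log (card X) / \<epsilon>)\<close> in summed loss when it gets a \<open>1 / T\<close> share of the privacy
  budget, and \<open>T = log 2 (\<epsilon> n)\<close> rounds leave a rounding error of \<open>L / (\<epsilon> n)\<close> per sample.\<close>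

section \<open>The exponential mechanism on a finite set\<close>

definition exp_mech :: "real \<Rightarrow> ('b \<Rightarrow> real) \<Rightarrow> 'b set \<Rightarrow> 'b pmf" where
  "exp_mech \<eta> S H =
     embed_pmf (\<lambda>h. if h \<in> H then exp (- (\<eta> * S h)) / (\<Sum>h'\<in>H. exp (- (\<eta> * S h'))) else 0)"

lemma pmf_exp_mech:
  assumes "finite H" "H \<noteq> {}"
  shows "pmf (exp_mech \<eta> S H) h =
    (if h \<in> H then exp (- (\<eta> * S h)) / (\<Sum>h'\<in>H. exp (- (\<eta> * S h'))) else 0)"
proof -
  define Z where "Z = (\<Sum>h'\<in>H. exp (- (\<eta> * S h')))"
  have Z: "Z > 0"
    unfolding Z_def using assms by (intro sum_pos) auto
  let ?w = "\<lambda>h. if h \<in> H then exp (- (\<eta> * S h)) / Z else 0"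
  have "(\<integral>\<^sup>+ h. ennreal (?w h) \<partial>count_space UNIV) = (\<Sum>h\<in>H. ennreal (?w h))"
    by (rule nn_integral_count_space') (use assms in auto)
  also have "\<dots> = ennreal (\<Sum>h\<in>H. ?w h)"
    using Z by (subst sum_ennreal) auto
  also have "(\<Sum>h\<in>H. ?w h) = Z / Z"
    by (simp flip: Z_def sum_divide_distrib)
  finally have "(\<integral>\<^sup>+ h. ennreal (?w h) \<partial>count_space UNIV) = 1"
    using Z by simp
  then show ?thesis
    unfolding exp_mech_def Z_def using Z[unfolded Z_def] by (subst pmf_embed_pmf) auto
qed

lemma set_pmf_exp_mech:
  assumes "finite H" "H \<noteq> {}"
  shows "set_pmf (exp_mech \<eta> S H) = H"
proof -
  have "0 < (\<Sum>h'\<in>H. exp (- (\<eta> * S h')))"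
    using assms by (intro sum_pos) auto
  then show ?thesis
    using assms by (auto simp: set_pmf_eq pmf_exp_mech)
qed

text \<open>The scores need to be close only up to a common shift \<open>c\<close>, which the normalisation cancels.\<close>

lemma pmf_exp_mech_le:
  assumes H: "finite H" "H \<noteq> {}" and "0 \<le> \<eta>"
    and close: "\<And>h. h \<in> H \<Longrightarrow> \<bar>S h - S' h - c\<bar> \<le> \<Delta>"
  shows "pmf (exp_mech \<eta> S H) h \<le> exp (2 * \<eta> * \<Delta>) * pmf (exp_mech \<eta> S' H) h"
proof (cases "h \<in> H")
  case True
  define Z Z' where "Z = (\<Sum>h\<in>H. exp (- (\<eta> * S h)))" and "Z' = (\<Sum>h\<in>H. exp (- (\<eta> * S' h)))"
  have pos: "Z > 0" "Z' > 0"
    unfolding Z_def Z'_def using H by (auto intro!: sum_pos)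
  have le: "exp (- (\<eta> * S h)) \<le> exp (\<eta> * \<Delta> - \<eta> * c) * exp (- (\<eta> * S' h))"
    and ge: "exp (- (\<eta> * S' h)) \<le> exp (\<eta> * \<Delta> + \<eta> * c) * exp (- (\<eta> * S h))" if "h \<in> H" for h
  proof -
    have "\<eta> * (S' h + c - S h) \<le> \<eta> * \<Delta>" "\<eta> * (S h - S' h - c) \<le> \<eta> * \<Delta>"
      using close[OF that] \<open>0 \<le> \<eta>\<close> by (auto intro!: mult_left_mono)
    then show "exp (- (\<eta> * S h)) \<le> exp (\<eta> * \<Delta> - \<eta> * c) * exp (- (\<eta> * S' h))"
      "exp (- (\<eta> * S' h)) \<le> exp (\<eta> * \<Delta> + \<eta> * c) * exp (- (\<eta> * S h))"
      by (auto simp: exp_add[symmetric] algebra_simps)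
  qed
  have "Z' \<le> exp (\<eta> * \<Delta> + \<eta> * c) * Z"
    unfolding Z_def Z'_def sum_distrib_left by (intro sum_mono ge)
  then have "1 / Z \<le> exp (\<eta> * \<Delta> + \<eta> * c) / Z'"
    using pos by (simp add: field_simps)
  \<comment> \<open>Numerator and normaliser each cost a factor with exponent
    \<open>\<eta> * \<Delta>\<close>; their factors in \<open>c\<close> are inverse to each
    other.\<close>
  then have "exp (- (\<eta> * S h)) * (1 / Z) \<le>
      exp (\<eta> * \<Delta> - \<eta> * c) * exp (- (\<eta> * S' h)) * (exp (\<eta> * \<Delta> + \<eta> * c) / Z')"
    using pos by (intro mult_mono le[OF True]) auto
  also have "\<dots> = exp (2 * \<eta> * \<Delta>) * (exp (- (\<eta> * S' h)) / Z')"
    by (simp add: exp_add[symmetric] field_simps)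
  finally show ?thesis
    using True by (simp add: pmf_exp_mech[OF H] Z_def Z'_def)
qed (simp add: pmf_exp_mech[OF H])

text \<open>Up to the factor \<open>\<eta>\<close> the expected score is the entropy of the output minus the logarithm of
  the partition function, and the entropy is at most \<open>ln (card H)\<close>.\<close>

lemma expectation_exp_mech_le:
  assumes H: "finite H" "H \<noteq> {}" and "0 < \<eta>"
  shows "measure_pmf.expectation (exp_mech \<eta> S H) S \<le> Min (S ` H) + ln (card H) / \<eta>"
proof -
  define Z where "Z = (\<Sum>h\<in>H. exp (- (\<eta> * S h)))"
  define p where "p = pmf (exp_mech \<eta> S H)"
  have Z: "Z > 0"
    unfolding Z_def using H by (auto intro!: sum_pos)
  have p: "p h = exp (- (\<eta> * S h)) / Z" if "h \<in> H" for h
    using that by (simp add: p_def pmf_exp_mech[OF H] Z_def)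
  have p1: "sum p H = 1"
    using Z by (simp add: p sum_divide_distrib[symmetric] flip: Z_def)
  have card: "card H > 0"
    using H by (simp add: card_gt_0_iff)
  \<comment> \<open>Gibbs' inequality against the uniform distribution, termwise from
    \<open>ln x \<le> x - 1\<close> at \<open>x = 1 / (card H * p h)\<close>. The last bracket sums
    to 0 over \<open>H\<close>.\<close>
  have "\<eta> * S h * p h \<le> - ln Z * p h + ln (card H) * p h + (1 / card H - p h)" if h: "h \<in> H" for h
  proof -
    have ph: "p h > 0"
      using Z by (simp add: p[OF h])
    have "\<eta> * S h = - ln (p h) - ln Z"
      using Z by (simp add: p[OF h] ln_div)
    moreover have "- ln (p h) - ln (card H) = ln (1 / (card H * p h))"
      using ph card by (simp add: ln_div ln_mult)
    moreover have "\<dots> \<le> 1 / (card H * p h) - 1"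
      using ph card by (intro ln_le_minus_one) auto
    ultimately have "\<eta> * S h * p h \<le> (- ln Z + ln (card H) + (1 / (card H * p h) - 1)) * p h"
      using ph by (intro mult_right_mono) auto
    also have "\<dots> = - ln Z * p h + ln (card H) * p h + (1 / card H - p h)"
      using ph card by (simp add: field_simps)
    finally show ?thesis .
  qed
  then have "(\<Sum>h\<in>H. \<eta> * S h * p h) \<le>
      (\<Sum>h\<in>H. - ln Z * p h + ln (card H) * p h + (1 / card H - p h))"
    by (intro sum_mono)
  also have "\<dots> = - ln Z + ln (card H)"
    using card p1 by (simp add: sum.distrib sum_subtractf sum_negf flip: sum_distrib_left)
  also have "- ln Z \<le> \<eta> * Min (S ` H)"
  proof -
    have "Min (S ` H) \<in> S ` H"
      using H by (intro Min_in) auto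
    then obtain h where "h \<in> H" and h: "Min (S ` H) = S h"
      by blast
    then have "exp (- (\<eta> * S h)) \<le> Z"
      unfolding Z_def using H by (intro member_le_sum) auto
    then have "ln (exp (- (\<eta> * S h))) \<le> ln Z"
      using Z by (subst ln_le_cancel_iff) auto
    then show ?thesis
      by (simp add: h)
  qed
  finally have "\<eta> * (\<Sum>h\<in>H. S h * p h) \<le> \<eta> * Min (S ` H) + ln (card H)"
    by (simp add: sum_distrib_left mult.assoc)
  then have "(\<Sum>h\<in>H. S h * p h) \<le> Min (S ` H) + ln (card H) / \<eta>"
    using \<open>0 < \<eta>\<close> by (simp add: field_simps)
  also have "(\<Sum>h\<in>H. S h * p h) = measure_pmf.expectation (exp_mech \<eta> S H) S"
    unfolding p_def using H
    by (subst integral_measure_pmf_real[of H]) (auto simp: set_pmf_exp_mech[OF H])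
  finally show ?thesis .
qed

section \<open>Pointwise domination of probability mass functions\<close>

text \<open>Reduces pure privacy of a discrete mechanism to a comparison of point masses.\<close>

lemma prob_le_of_pmf_le:
  assumes "0 \<le> c" "\<And>x. pmf p x \<le> c * pmf q x"
  shows "measure_pmf.prob p A \<le> c * measure_pmf.prob q A"
proof -
  have "emeasure p A = (\<integral>\<^sup>+ x. ennreal (pmf p x) * indicator A x \<partial>count_space UNIV)"
    by (simp flip: nn_integral_measure_pmf)
  also have "\<dots> \<le> (\<integral>\<^sup>+ x. ennreal c * (ennreal (pmf q x) * indicator A x) \<partial>count_space UNIV)"
    using assms
    by (intro nn_integral_mono) (auto simp: ennreal_mult[symmetric] split: split_indicator intro: ennreal_leI)
  also have "\<dots> = ennreal c * emeasure q A"
    by (simp add: nn_integral_cmult flip: nn_integral_measure_pmf)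
  finally show ?thesis
    using \<open>0 \<le> c\<close> by (simp add: measure_pmf.emeasure_eq_measure ennreal_mult[symmetric])
qed

text \<open>Adaptive composition of pure privacy: the factors of the two stages multiply along every
  path. The second stage is compared only on reachable states, where the exponential mechanism is
  known to be well defined.\<close>

lemma pmf_bind_le:
  assumes "0 \<le> a" "0 \<le> b" and p: "\<And>x. pmf p x \<le> a * pmf q x"
    and K: "\<And>x. x \<in> set_pmf p \<Longrightarrow> pmf (K x) y \<le> b * pmf (K' x) y"
  shows "pmf (bind_pmf p K) y \<le> a * b * pmf (bind_pmf q K') y"
proof -
  have "ennreal (pmf (bind_pmf p K) y) =
      (\<integral>\<^sup>+ x. ennreal (pmf p x) * ennreal (pmf (K x) y) \<partial>count_space UNIV)"
    by (simp add: ennreal_pmf_bind nn_integral_measure_pmf)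
  also have "\<dots> \<le> (\<integral>\<^sup>+ x. ennreal (a * b) * (ennreal (pmf q x) * ennreal (pmf (K' x) y)) \<partial>count_space UNIV)"
  proof (intro nn_integral_mono)
    fix x
    have "pmf p x * pmf (K x) y \<le> (a * pmf q x) * (b * pmf (K' x) y)"
    proof (cases "x \<in> set_pmf p")
      case True
      then show ?thesis
        using assms by (intro mult_mono) auto
    next
      case False
      then show ?thesis
        using assms by (simp add: set_pmf_eq)
    qed
    then show "ennreal (pmf p x) * ennreal (pmf (K x) y) \<le>
        ennreal (a * b) * (ennreal (pmf q x) * ennreal (pmf (K' x) y))"
      using assms by (simp add: ennreal_mult[symmetric] mult_ac ennreal_leI)
  qed
  also have "\<dots> = ennreal (a * b * pmf (bind_pmf q K') y)"
    using assms by (simp add: nn_integral_cmult ennreal_pmf_bind nn_integral_measure_pmf ennreal_mult)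
  finally show ?thesis
    using assms by simp
qed

section \<open>Counting monotone refinements\<close>

text \<open>Such a subset is listed by an \<open>m\<close>-tuple over \<open>X\<close> padded with
  \<open>None\<close>, hence the base \<open>card X + 1\<close>.\<close>

lemma card_bounded_subsets_le:
  assumes "finite X"
  shows "finite {A. A \<subseteq> X \<and> card A \<le> m}" "card {A. A \<subseteq> X \<and> card A \<le> m} \<le> (card X + 1) ^ m"
proof -
  show "finite {A. A \<subseteq> X \<and> card A \<le> m}"
    using assms by simp
  have "{A. A \<subseteq> X \<and> card A \<le> m} \<subseteq>
      (\<lambda>f. {x. Some x \<in> f ` {..<m}}) ` ({..<m} \<rightarrow>\<^sub>E insert None (Some ` X))"
  proof
    fix A assume "A \<in> {A. A \<subseteq> X \<and> card A \<le> m}"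
    then have A: "A \<subseteq> X" "card A \<le> m" "finite A"
      using assms finite_subset by auto
    obtain e where e: "bij_betw e {0..<card A} A"
      using ex_bij_betw_nat_finite[OF A(3)] by blast
    let ?f = "\<lambda>i\<in>{..<m}. if i < card A then Some (e i) else None"
    have "{x. Some x \<in> ?f ` {..<m}} = e ` {0..<card A}"
      using A(2) by (force simp: image_iff split: if_splits)
    then have "A = {x. Some x \<in> ?f ` {..<m}}"
      using e by (simp add: bij_betw_def)
    moreover have "e i \<in> X" if "i < card A" for i
      using bij_betwE[OF e] A(1) that by (meson atLeastLessThan_iff subsetD zero_le)
    then have "?f \<in> {..<m} \<rightarrow>\<^sub>E insert None (Some ` X)"
      by auto
    ultimately show "A \<in> (\<lambda>f. {x. Some x \<in> f ` {..<m}}) ` ({..<m} \<rightarrow>\<^sub>E insert None (Some ` X))"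
      by blast
  qed
  then have "card {A. A \<subseteq> X \<and> card A \<le> m} \<le> card ({..<m} \<rightarrow>\<^sub>E insert None (Some ` X))"
    using assms by (intro surj_card_le finite_PiE) auto
  also have "\<dots> = (card X + 1) ^ m"
    using assms by (simp add: card_PiE card_image)
  finally show "card {A. A \<subseteq> X \<and> card A \<le> m} \<le> (card X + 1) ^ m" .
qed

text \<open>Descent inside \<open>V\<close>: a strictly smaller element has fewer elements of
  \<open>V\<close> below it.\<close>

lemma ex_minimal_below:
  assumes "finite V" "partial_order_on X r" "V \<subseteq> X" "x \<in> V"
  shows "\<exists>a\<in>V. (a, x) \<in> r \<and> (\<forall>y\<in>V. (y, a) \<in> r \<longrightarrow> y = a)"
  using \<open>x \<in> V\<close>
proof (induction "card {y \<in> V. (y, x) \<in> r}" arbitrary: x rule: less_induct)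
  case less
  note r = partial_order_onD[OF assms(2)]
  have refl: "(x, x) \<in> r"
    using less.prems assms(3) r(1) by (auto simp: refl_on_def)
  show ?case
  proof (cases "\<forall>y\<in>V. (y, x) \<in> r \<longrightarrow> y = x")
    case True
    then show ?thesis
      using refl less.prems by blast
  next
    case False
    then obtain y where y: "y \<in> V" "(y, x) \<in> r" "y \<noteq> x"
      by blast
    have "{z \<in> V. (z, y) \<in> r} \<subset> {z \<in> V. (z, x) \<in> r}"
      using y less.prems refl r(2,3) by (auto dest: transD antisymD)
    then have "card {z \<in> V. (z, y) \<in> r} < card {z \<in> V. (z, x) \<in> r}"
      using assms(1) by (intro psubset_card_mono) auto
    from less.hyps[OF this y(1)] show ?thesis
      using y(2) r(2) by (meson transD)
  qed
qed

lemma card_antichain_le_width: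
  assumes "finite X" "antichain_in X r A"
  shows "card A \<le> width X r"
proof -
  have "{A. antichain_in X r A} \<subseteq> Pow X"
    by (auto simp: antichain_in_def)
  then have "finite {A. antichain_in X r A}"
    using assms(1) finite_subset by blast
  then show ?thesis
    unfolding width_def using assms(2) by (intro Max_ge) auto
qed

text \<open>The state \<open>k\<close> at level \<open>t\<close> says that the prediction at \<open>x\<close> lies in the dyadic interval
  \<open>[k x / 2 ^ t, (k x + 1) / 2 ^ t)\<close>; a refinement by \<open>d\<close> levels keeps the leading digits.\<close>

definition refinements :: "'a set \<Rightarrow> 'a rel \<Rightarrow> nat \<Rightarrow> ('a \<Rightarrow> nat) \<Rightarrow> ('a \<Rightarrow> nat) set" where
  "refinements X r d k = {g \<in> extensional X. monotone_on X (\<lambda>x x'. (x, x') \<in> r) (\<le>) g \<and>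
     (\<forall>x\<in>X. g x div 2 ^ d = k x)}"

lemma refinements_bounds:
  assumes "g \<in> refinements X r d k" "x \<in> X"
  shows "k x * 2 ^ d \<le> g x" "g x < (k x + 1) * 2 ^ d"
proof -
  have "g x div 2 ^ d = k x"
    using assms by (simp add: refinements_def)
  then show "k x * 2 ^ d \<le> g x" "g x < (k x + 1) * 2 ^ d"
    using dividend_less_div_times[of "2 ^ d" "g x"] div_times_less_eq_dividend[of "g x" "2 ^ d"]
    by (auto simp: algebra_simps)
qed

lemma finite_refinements:
  assumes "finite X"
  shows "finite (refinements X r d k)"
proof -
  have "refinements X r d k \<subseteq> (\<Pi>\<^sub>E x\<in>X. {..<(k x + 1) * 2 ^ d})"
  proof
    fix g assume g: "g \<in> refinements X r d k"
    then show "g \<in> (\<Pi>\<^sub>E x\<in>X. {..<(k x + 1) * 2 ^ d})"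
      using refinements_bounds(2)[OF g] by (auto simp: PiE_iff refinements_def)
  qed
  then show ?thesis
    using assms by (auto intro: finite_subset finite_PiE)
qed

lemma refinements_nonempty:
  assumes "monotone_on X (\<lambda>x x'. (x, x') \<in> r) (\<le>) k"
  shows "refinements X r d k \<noteq> {}"
proof -
  have "(\<lambda>x\<in>X. k x * 2 ^ d) \<in> refinements X r d k"
    using assms by (auto simp: refinements_def monotone_on_def)
  then show ?thesis by blast
qed

lemma monotone_refinements:
  "g \<in> refinements X r d k \<Longrightarrow> monotone_on X (\<lambda>x x'. (x, x') \<in> r) (\<le>) g"
  by (simp add: refinements_def)

lemma refinements_0:
  assumes "k \<in> extensional X" "monotone_on X (\<lambda>x x'. (x, x') \<in> r) (\<le>) k"
  shows "refinements X r 0 k = {k}"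
  using assms by (auto simp: refinements_def extensionalityI)

lemma refinements_refinements:
  assumes "h \<in> refinements X r d k" "g \<in> refinements X r e h"
  shows "g \<in> refinements X r (e + d) k"
  using assms by (auto simp: refinements_def power_add div_mult2_eq)

text \<open>The intermediate state drops the last \<open>e\<close> binary digits of
  \<open>g\<close>; truncation preserves monotonicity.\<close>

lemma refinements_add:
  "refinements X r (e + d) k = (\<Union>h\<in>refinements X r d k. refinements X r e h)"
proof (intro equalityI subsetI)
  fix g assume g: "g \<in> refinements X r (e + d) k"
  have "(\<lambda>x\<in>X. g x div 2 ^ e) \<in> refinements X r d k"
    using g by (auto simp: refinements_def monotone_on_def power_add div_mult2_eq div_le_mono)
  moreover have "g \<in> refinements X r e (\<lambda>x\<in>X. g x div 2 ^ e)"
    using g by (auto simp: refinements_def)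
  ultimately show "g \<in> (\<Union>h\<in>refinements X r d k. refinements X r e h)" by blast
qed (auto intro: refinements_refinements)

text \<open>A one-level refinement adds a bit to \<open>k\<close> on an upper set of each level set of \<open>k\<close>, and these
  upper sets are recovered from their minimal elements, at most \<open>width X r\<close> in each of the at
  most \<open>N\<close> level sets.\<close>

lemma card_refinements_le:
  assumes X: "finite X" and po: "partial_order_on X r" and k: "\<And>x. x \<in> X \<Longrightarrow> k x < N"
  shows "card (refinements X r 1 k) \<le> (card X + 1) ^ (width X r * N)"
proof -
  define V where "V h = {x \<in> X. odd (h x)}" for h :: "'a \<Rightarrow> nat"
  define A where "A h = {x \<in> V h. \<forall>y\<in>V h. k y = k x \<and> (y, x) \<in> r \<longrightarrow> y = x}" for h
  have V_eq: "V h = {x \<in> X. \<exists>a\<in>A h. k a = k x \<and> (a, x) \<in> r}"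
    if h: "h \<in> refinements X r 1 k" for h
  proof (intro equalityI subsetI)
    fix x assume x: "x \<in> V h"
    have "\<exists>a\<in>{y \<in> V h. k y = k x}. (a, x) \<in> r \<and> (\<forall>y\<in>{y \<in> V h. k y = k x}. (y, a) \<in> r \<longrightarrow> y = a)"
      using X po x by (intro ex_minimal_below[where X = X]) (auto simp: V_def)
    then show "x \<in> {x \<in> X. \<exists>a\<in>A h. k a = k x \<and> (a, x) \<in> r}"
      using x by (auto simp: A_def V_def)
  next
    fix x assume "x \<in> {x \<in> X. \<exists>a\<in>A h. k a = k x \<and> (a, x) \<in> r}"
    then obtain a where a: "x \<in> X" "a \<in> X" "odd (h a)" "k a = k x" "(a, x) \<in> r"
      by (auto simp: A_def V_def)
    have "h a \<le> h x"
      using h a by (auto simp: refinements_def monotone_on_def)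
    moreover have "h a div 2 = h x div 2"
      using h a by (simp add: refinements_def)
    \<comment> \<open>An odd \<open>h a\<close> is already the largest number with its half, so
      \<open>h x = h a\<close>.\<close>
    ultimately have "odd (h x)"
      using a(3) by presburger
    then show "x \<in> V h"
      using a(1) by (simp add: V_def)
  qed
  have "inj_on A (refinements X r 1 k)"
  proof (rule inj_onI)
    fix g h assume gh: "g \<in> refinements X r 1 k" "h \<in> refinements X r 1 k" "A g = A h"
    then have V: "V g = V h"
      using V_eq by auto
    show "g = h"
    proof (rule extensionalityI)
      fix x assume x: "x \<in> X"
      then have "g x div 2 = h x div 2" "odd (g x) = odd (h x)"
        using gh V by (auto simp: refinements_def V_def)
      then show "g x = h x"
        by presburger
    qed (use gh in \<open>auto simp: refinements_def\<close>)
  qed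
  moreover have "A ` refinements X r 1 k \<subseteq> {B. B \<subseteq> X \<and> card B \<le> width X r * N}"
  proof safe
    fix h assume h: "h \<in> refinements X r 1 k"
    show "\<And>x. x \<in> A h \<Longrightarrow> x \<in> X"
      by (simp add: A_def V_def)
    \<comment> \<open>Minimal elements are pairwise incomparable only within one level set, so the
      width bounds each level separately.\<close>
    have "A h = (\<Union>j<N. {x \<in> A h. k x = j})"
      using k by (auto simp: A_def V_def)
    also have "card \<dots> \<le> (\<Sum>j<N. card {x \<in> A h. k x = j})"
      by (intro card_UN_le) auto
    also have "\<dots> \<le> (\<Sum>j<N. width X r)"
      by (intro sum_mono card_antichain_le_width[OF X]) (auto simp: antichain_in_def A_def V_def)
    finally show "card (A h) \<le> width X r * N"
      by (simp add: mult.commute)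
  qed
  ultimately have "card (refinements X r 1 k) \<le> card {B. B \<subseteq> X \<and> card B \<le> width X r * N}"
    using card_bounded_subsets_le(1)[OF X] by (metis card_image card_mono)
  also have "\<dots> \<le> (card X + 1) ^ (width X r * N)"
    by (rule card_bounded_subsets_le(2)[OF X])
  finally show ?thesis .
qed

section \<open>Privacy and risk of the dyadic descent\<close>

text \<open>A sum and not a mean, so that the influence of a single sample does not depend on the
  size of the dataset.\<close>

definition grid_loss ::
    "(real \<Rightarrow> real \<Rightarrow> real) \<Rightarrow> nat \<Rightarrow> ('a \<times> real) list \<Rightarrow> ('a \<Rightarrow> nat) \<Rightarrow> real" where
  "grid_loss \<l> T D g = (\<Sum>i<length D. \<l> (real (g (fst (D ! i))) / 2 ^ T) (snd (D ! i)))"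

text \<open>The cost-to-go of dynamic programming: the least final loss still attainable from
  \<open>k\<close> with \<open>d\<close> levels left.\<close>

definition best_loss ::
    "'a set \<Rightarrow> 'a rel \<Rightarrow> (real \<Rightarrow> real \<Rightarrow> real) \<Rightarrow> nat \<Rightarrow> ('a \<times> real) list
      \<Rightarrow> nat \<Rightarrow> ('a \<Rightarrow> nat) \<Rightarrow> real" where
  "best_loss X r \<l> T D d k = Min (grid_loss \<l> T D ` refinements X r d k)"

text \<open>The inverse temperature doubles from round to round because the sensitivity of the
  scores halves.\<close>

primrec descent ::
    "'a set \<Rightarrow> 'a rel \<Rightarrow> (real \<Rightarrow> real \<Rightarrow> real) \<Rightarrow> nat \<Rightarrow> real \<Rightarrow> ('a \<times> real) list
      \<Rightarrow> nat \<Rightarrow> ('a \<Rightarrow> nat) pmf" where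
  "descent X r \<l> T c D 0 = return_pmf (\<lambda>x\<in>X. 0)"
| "descent X r \<l> T c D (Suc t) = bind_pmf (descent X r \<l> T c D t)
     (\<lambda>k. exp_mech (c * 2 ^ t) (best_loss X r \<l> T D (T - Suc t)) (refinements X r 1 k))"

lemma set_pmf_descent:
  assumes "finite X"
  shows "set_pmf (descent X r \<l> T c D t) \<subseteq> refinements X r t (\<lambda>x\<in>X. 0)"
proof (induction t)
  case 0
  show ?case
    by (auto simp: refinements_def monotone_on_def)
next
  case (Suc t)
  have "set_pmf (exp_mech \<eta> S (refinements X r 1 k)) \<subseteq> refinements X r (Suc t) (\<lambda>x\<in>X. 0)"
    if "k \<in> refinements X r t (\<lambda>x\<in>X. 0)" for \<eta> S k
  proof -
    have "set_pmf (exp_mech \<eta> S (refinements X r 1 k)) = refinements X r 1 k"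
      using finite_refinements[OF assms] refinements_nonempty[OF monotone_refinements[OF that]]
      by (rule set_pmf_exp_mech)
    then show ?thesis
      using refinements_refinements[OF that, of _ 1] by auto
  qed
  then show ?case
    using Suc unfolding descent.simps set_bind_pmf by blast
qed

lemma refinements_zero_less:
  assumes "k \<in> refinements X r t (\<lambda>x\<in>X. 0)" "x \<in> X"
  shows "k x < 2 ^ t"
  using refinements_bounds(2)[OF assms] assms(2) by simp

section \<open>Sensitivity of the scores and privacy of the descent\<close>

text \<open>Each minimum is at most its function's value at the minimiser of the other.\<close>

lemma abs_Min_diff_le:
  fixes f f' :: "'b \<Rightarrow> real"
  assumes "finite G" "G \<noteq> {}" and close: "\<And>g. g \<in> G \<Longrightarrow> \<bar>f g - f' g - c\<bar> \<le> \<Delta>"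
  shows "\<bar>Min (f ` G) - Min (f' ` G) - c\<bar> \<le> \<Delta>"
proof -
  have "Min (f ` G) \<in> f ` G" "Min (f' ` G) \<in> f' ` G"
    using assms by (auto intro!: Min_in)
  then obtain g g' where g: "g \<in> G" "Min (f ` G) = f g" and g': "g' \<in> G" "Min (f' ` G) = f' g'"
    by blast
  have "f g \<le> f g'" "f' g' \<le> f' g"
    using assms(1) g g' by (metis Min_le finite_imageI imageI)+
  then show ?thesis
    using close[OF g(1)] close[OF g'(1)] unfolding g(2) g'(2) by linarith
qed

lemma lipschitz_lossD:
  assumes "lipschitz_loss L \<l>" "y \<in> {0..1}" "a \<in> {0..1}" "b \<in> {0..1}"
  shows "\<bar>\<l> a y - \<l> b y\<bar> \<le> L * \<bar>a - b\<bar>"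
  using assms lipschitz_onD[of L "{0..1}" "\<lambda>t. \<l> t y" a b]
  by (auto simp: lipschitz_loss_def dist_real_def)

lemma lipschitz_loss_nonneg:
  assumes "lipschitz_loss L \<l>"
  shows "0 \<le> L"
proof -
  have "L-lipschitz_on {0..1} (\<lambda>t. \<l> t 0)"
    using assms by (auto simp: lipschitz_loss_def)
  then show ?thesis
    by (rule lipschitz_on_nonneg)
qed

text \<open>Both predictions lie in the same dyadic interval of length
  \<open>1 / 2 ^ t\<close>.\<close>

lemma grid_loss_term_close:
  assumes \<l>: "lipschitz_loss L \<l>" and "t \<le> T" "x \<in> X" "y \<in> {0..1}"
    and k: "k \<in> refinements X r t (\<lambda>x\<in>X. 0)" and g: "g \<in> refinements X r (T - t) k"
  shows "\<bar>\<l> (real (g x) / 2 ^ T) y - \<l> (real (k x) / 2 ^ t) y\<bar> \<le> L / 2 ^ t"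
proof -
  have T: "(2::real) ^ T = 2 ^ t * 2 ^ (T - t)"
    using \<open>t \<le> T\<close> by (simp flip: power_add)
  have kx: "real (k x) + 1 \<le> 2 ^ t"
    using refinements_zero_less[OF k \<open>x \<in> X\<close>] by (simp add: nat_less_real_le)
  have "real (k x * 2 ^ (T - t)) \<le> real (g x)" "real (g x) \<le> real ((k x + 1) * 2 ^ (T - t))"
    unfolding of_nat_le_iff using refinements_bounds[OF g \<open>x \<in> X\<close>] by auto
  then have gx: "real (k x) / 2 ^ t \<le> real (g x) / 2 ^ T" "real (g x) / 2 ^ T \<le> (real (k x) + 1) / 2 ^ t"
    unfolding T by (auto simp: field_simps)
  have le1: "(real (k x) + 1) / 2 ^ t \<le> 1"
    using kx by (simp add: divide_le_eq)
  \<comment> \<open>The loss is Lipschitz only on the unit interval.\<close>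
  have "real (k x) / 2 ^ t \<in> {0..1}" "real (g x) / 2 ^ T \<in> {0..1}"
    using gx order_trans[OF gx(2) le1] order_trans[OF gx(1) order_trans[OF gx(2) le1]]
    unfolding atLeastAtMost_iff by (blast intro: divide_nonneg_nonneg of_nat_0_le_iff zero_le_power zero_le_numeral)+
  then have "\<bar>\<l> (real (g x) / 2 ^ T) y - \<l> (real (k x) / 2 ^ t) y\<bar>
      \<le> L * \<bar>real (g x) / 2 ^ T - real (k x) / 2 ^ t\<bar>"
    by (intro lipschitz_lossD[OF \<l> \<open>y \<in> {0..1}\<close>])
  also have "\<dots> \<le> L * (1 / 2 ^ t)"
    using gx by (intro mult_left_mono lipschitz_loss_nonneg[OF \<l>]) (auto simp: add_divide_distrib)
  finally show ?thesis by simp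
qed

lemma datasets_nth:
  assumes "D \<in> datasets X n" "i < n"
  shows "fst (D ! i) \<in> X" "snd (D ! i) \<in> {0..1}"
proof -
  have "D ! i \<in> X \<times> {0..1}"
    using assms nth_mem[of i D] unfolding datasets_def by blast
  then show "fst (D ! i) \<in> X" "snd (D ! i) \<in> {0..1}"
    by (auto simp: mem_Times_iff)
qed

lemma length_datasets: "D \<in> datasets X n \<Longrightarrow> length D = n"
  by (simp add: datasets_def)

text \<open>All samples but the \<open>i\<close>-th cancel. The loss at that sample, under
  \<open>D\<close> and under \<open>D'\<close>, is within \<open>L / 2 ^ t\<close> of its value at
  the left interval endpoint given by \<open>k\<close>; this accounts for the factor 2.\<close>

lemma best_loss_close:
  assumes X: "finite X" and \<l>: "lipschitz_loss L \<l>" and "t < T"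
    and D: "D \<in> datasets X n" "D' \<in> datasets X n" "neighboring D D'"
    and k: "k \<in> refinements X r t (\<lambda>x\<in>X. 0)"
  shows "\<exists>c. \<forall>h\<in>refinements X r 1 k.
    \<bar>best_loss X r \<l> T D (T - Suc t) h - best_loss X r \<l> T D' (T - Suc t) h - c\<bar> \<le> 2 * L / 2 ^ t"
proof -
  obtain i where i: "i < length D" and eq: "\<And>j. j < length D \<Longrightarrow> j \<noteq> i \<Longrightarrow> D ! j = D' ! j"
    and len: "length D' = length D"
    using D(3) unfolding neighboring_def by metis
  have "i < n"
    using i length_datasets[OF D(1)] by simp
  note Di = datasets_nth[OF D(1) this] datasets_nth[OF D(2) this]
  define loss_at where "loss_at E s g = \<l> (real (g (fst (E ! i))) / 2 ^ s) (snd (E ! i))"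
    for E :: "('a \<times> real) list" and s and g :: "'a \<Rightarrow> nat"
  \<comment> \<open>The shift depends on the current state \<open>k\<close> but not on the candidate
    \<open>h\<close>, as the exponential mechanism requires.\<close>
  define c where "c = loss_at D t k - loss_at D' t k"
  have diff: "grid_loss \<l> T D g - grid_loss \<l> T D' g = loss_at D T g - loss_at D' T g" for g
  proof -
    have "(\<Sum>j\<in>{..<length D} - {i}. \<l> (real (g (fst (D ! j))) / 2 ^ T) (snd (D ! j))) =
        (\<Sum>j\<in>{..<length D} - {i}. \<l> (real (g (fst (D' ! j))) / 2 ^ T) (snd (D' ! j)))"
      by (intro sum.cong) (auto simp: eq)
    then show ?thesis
      using i len by (simp add: grid_loss_def loss_at_def sum.remove[of "{..<length D}" i])
  qed
  have "\<bar>best_loss X r \<l> T D (T - Suc t) h - best_loss X r \<l> T D' (T - Suc t) h - c\<bar> \<le> 2 * L / 2 ^ t"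
    if h: "h \<in> refinements X r 1 k" for h
    unfolding best_loss_def
  proof (rule abs_Min_diff_le)
    fix g assume "g \<in> refinements X r (T - Suc t) h"
    then have g: "g \<in> refinements X r (T - t) k"
      using refinements_refinements[OF h, of g "T - Suc t"] \<open>t < T\<close> by (simp add: Suc_diff_Suc)
    show "\<bar>grid_loss \<l> T D g - grid_loss \<l> T D' g - c\<bar> \<le> 2 * L / 2 ^ t"
      using grid_loss_term_close[OF \<l> less_imp_le[OF \<open>t < T\<close>] Di(1,2) k g]
        grid_loss_term_close[OF \<l> less_imp_le[OF \<open>t < T\<close>] Di(3,4) k g]
      unfolding diff c_def loss_at_def by linarith
  qed (rule finite_refinements[OF X] refinements_nonempty[OF monotone_refinements[OF h]])+
  then show ?thesis by blast
qed

text \<open>Every round costs the same exponent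
  \<open>2 * (c * 2 ^ t) * (2 * L / 2 ^ t) = 4 * c * L\<close>, and composition adds these
  up.\<close>

lemma pmf_descent_le:
  assumes X: "finite X" and \<l>: "lipschitz_loss L \<l>" and "0 \<le> c"
    and D: "D \<in> datasets X n" "D' \<in> datasets X n" "neighboring D D'"
  shows "t \<le> T \<Longrightarrow> pmf (descent X r \<l> T c D t) k \<le>
    exp (4 * c * L * real t) * pmf (descent X r \<l> T c D' t) k"
proof (induction t arbitrary: k)
  case (Suc t)
  have "pmf (descent X r \<l> T c D (Suc t)) k \<le>
      exp (4 * c * L * real t) * exp (4 * c * L) * pmf (descent X r \<l> T c D' (Suc t)) k"
    unfolding descent.simps
  proof (rule pmf_bind_le)
    fix h assume "h \<in> set_pmf (descent X r \<l> T c D t)"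
    then have h: "h \<in> refinements X r t (\<lambda>x\<in>X. 0)"
      using set_pmf_descent[OF X] by blast
    obtain s where s: "\<And>h'. h' \<in> refinements X r 1 h \<Longrightarrow>
        \<bar>best_loss X r \<l> T D (T - Suc t) h' - best_loss X r \<l> T D' (T - Suc t) h' - s\<bar> \<le> 2 * L / 2 ^ t"
      using best_loss_close[OF X \<l> Suc_le_lessD[OF Suc.prems] D h] by blast
    have "pmf (exp_mech (c * 2 ^ t) (best_loss X r \<l> T D (T - Suc t)) (refinements X r 1 h)) k
        \<le> exp (2 * (c * 2 ^ t) * (2 * L / 2 ^ t)) *
          pmf (exp_mech (c * 2 ^ t) (best_loss X r \<l> T D' (T - Suc t)) (refinements X r 1 h)) k"
      using h \<open>0 \<le> c\<close> s X
      by (intro pmf_exp_mech_le finite_refinements refinements_nonempty monotone_refinements) auto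
    then show "pmf (exp_mech (c * 2 ^ t) (best_loss X r \<l> T D (T - Suc t)) (refinements X r 1 h)) k
        \<le> exp (4 * c * L) *
          pmf (exp_mech (c * 2 ^ t) (best_loss X r \<l> T D' (T - Suc t)) (refinements X r 1 h)) k"
      by (simp add: mult_ac)
  qed (use Suc in auto)
  then show ?case
    by (simp add: exp_add[symmetric] algebra_simps)
qed simp

section \<open>Loss accumulated over the rounds\<close>

text \<open>The best deep refinement of \<open>k\<close> passes through some one-level refinement,
  so an optimal choice of the next bit loses nothing.\<close>

lemma Min_best_loss_le:
  assumes X: "finite X" and "monotone_on X (\<lambda>x x'. (x, x') \<in> r) (\<le>) k"
  shows "Min (best_loss X r \<l> T D d ` refinements X r 1 k) \<le> best_loss X r \<l> T D (Suc d) k"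
proof -
  have "best_loss X r \<l> T D (Suc d) k \<in> grid_loss \<l> T D ` refinements X r (Suc d) k"
    unfolding best_loss_def using finite_refinements[OF X] refinements_nonempty[OF assms(2)]
    by (intro Min_in) auto
  then obtain g where g: "g \<in> refinements X r (d + 1) k"
      and best: "best_loss X r \<l> T D (Suc d) k = grid_loss \<l> T D g"
    by auto
  obtain h where h: "h \<in> refinements X r 1 k" "g \<in> refinements X r d h"
    using g unfolding refinements_add by blast
  have "Min (best_loss X r \<l> T D d ` refinements X r 1 k) \<le> best_loss X r \<l> T D d h"
    using h finite_refinements[OF X] by (intro Min_le) auto
  also have "\<dots> \<le> grid_loss \<l> T D g"
    unfolding best_loss_def using h finite_refinements[OF X] by (intro Min_le) auto
  finally show ?thesis
    by (simp add: best)
qed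

text \<open>The factor \<open>2 ^ t\<close> in the logarithm of the number of refinements cancels against the one in the
  inverse temperature, so all rounds lose the same amount.\<close>

lemma expectation_descent_le:
  assumes X: "finite X" and po: "partial_order_on X r" and "0 < c"
  shows "t \<le> T \<Longrightarrow> measure_pmf.expectation (descent X r \<l> T c D t) (best_loss X r \<l> T D (T - t))
    \<le> best_loss X r \<l> T D T (\<lambda>x\<in>X. 0) + real t * (real (width X r) * ln (real (card X) + 1) / c)"
proof (induction t)
  case (Suc t)
  let ?p = "descent X r \<l> T c D t" and ?R = "refinements X r t (\<lambda>x\<in>X. 0)"
    and ?B = "best_loss X r \<l> T D"
  let ?K = "\<lambda>k. exp_mech (c * 2 ^ t) (?B (T - Suc t)) (refinements X r 1 k)"
    and ?gap = "real (width X r) * ln (real (card X) + 1) / c"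
  have fin: "finite ?R" "set_pmf ?p \<subseteq> ?R"
    using finite_refinements[OF X] set_pmf_descent[OF X] by auto
  have step: "measure_pmf.expectation (?K k) (?B (T - Suc t)) \<le> ?B (T - t) k + ?gap" if k: "k \<in> ?R" for k
  proof -
    have H: "finite (refinements X r 1 k)" "refinements X r 1 k \<noteq> {}"
      using k finite_refinements[OF X] refinements_nonempty monotone_refinements by blast+
    have "card (refinements X r 1 k) \<le> (card X + 1) ^ (width X r * 2 ^ t)"
      by (rule card_refinements_le[OF X po]) (rule refinements_zero_less[OF k])
    then have "real (card (refinements X r 1 k)) \<le> real ((card X + 1) ^ (width X r * 2 ^ t))"
      by (simp only: of_nat_le_iff)
    moreover have "0 < card (refinements X r 1 k)"
      using H by (simp add: card_gt_0_iff)
    ultimately have "ln (real (card (refinements X r 1 k))) \<le> ln (real ((card X + 1) ^ (width X r * 2 ^ t)))"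
      by (intro ln_mono) auto
    also have "\<dots> = real (width X r * 2 ^ t) * ln (real (card X) + 1)"
      by (simp add: ln_realpow add.commute)
    finally have "ln (real (card (refinements X r 1 k))) / (c * 2 ^ t) \<le> ?gap"
      using \<open>0 < c\<close> by (simp add: field_simps)
    moreover have "Min (?B (T - Suc t) ` refinements X r 1 k) \<le> ?B (T - t) k"
      using Min_best_loss_le[OF X monotone_refinements[OF k], of \<l> T D "T - Suc t"] Suc.prems
      by (simp add: Suc_diff_Suc)
    moreover have "0 < c * 2 ^ t"
      using \<open>0 < c\<close> by simp
    ultimately show ?thesis
      using expectation_exp_mech_le[OF H, of "c * 2 ^ t" "?B (T - Suc t)"] by linarith
  qed
  have "measure_pmf.expectation (descent X r \<l> T c D (Suc t)) (?B (T - Suc t)) =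
      (\<Sum>k\<in>?R. pmf ?p k * measure_pmf.expectation (?K k) (?B (T - Suc t)))"
  proof -
    have "finite (set_pmf (?K k))" if "k \<in> ?R" for k
    proof -
      have "finite (refinements X r 1 k)" "refinements X r 1 k \<noteq> {}"
        using that finite_refinements[OF X] refinements_nonempty monotone_refinements by blast+
      then show ?thesis
        by (simp add: set_pmf_exp_mech)
    qed
    then show ?thesis
      using fin by (simp add: pmf_expectation_bind[of ?R])
  qed
  also have "\<dots> \<le> (\<Sum>k\<in>?R. pmf ?p k * (?B (T - t) k + ?gap))"
    by (intro sum_mono mult_left_mono step) auto
  also have "\<dots> = (\<Sum>k\<in>?R. ?B (T - t) k * pmf ?p k) + ?gap * (\<Sum>k\<in>?R. pmf ?p k)"
    by (simp add: algebra_simps sum.distrib sum_distrib_left)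
  also have "(\<Sum>k\<in>?R. pmf ?p k) = 1"
    using fin by (intro sum_pmf_eq_1)
  also have "(\<Sum>k\<in>?R. ?B (T - t) k * pmf ?p k) = measure_pmf.expectation ?p (?B (T - t))"
    using fin by (subst integral_measure_pmf_real[of ?R]) auto
  finally have "measure_pmf.expectation (descent X r \<l> T c D (Suc t)) (?B (T - Suc t)) \<le>
      measure_pmf.expectation ?p (?B (T - t)) + ?gap"
    by simp
  also have "\<dots> \<le> ?B T (\<lambda>x\<in>X. 0) + real t * ?gap + ?gap"
    by (intro add_right_mono Suc.IH Suc_leD[OF Suc.prems])
  also have "\<dots> = ?B T (\<lambda>x\<in>X. 0) + real (Suc t) * ?gap"
    by (simp only: of_nat_Suc distrib_right mult_1 add_ac)
  finally show ?case .
qed simp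

text \<open>Rounding \<open>f\<close> down to the grid keeps it monotone and costs at most
  \<open>L / 2 ^ T\<close> per sample.\<close>

lemma best_loss_root_le:
  assumes X: "finite X" and \<l>: "lipschitz_loss L \<l>" and D: "D \<in> datasets X n"
    and f: "f \<in> isotonic_functions X r"
  shows "best_loss X r \<l> T D T (\<lambda>x\<in>X. 0) \<le>
    (\<Sum>i<n. \<l> (f (fst (D ! i))) (snd (D ! i))) + real n * L / 2 ^ T"
proof -
  \<comment> \<open>The cap handles \<open>f x = 1\<close>, whose floor \<open>2 ^ T\<close> would
    leave the root interval.\<close>
  define g where "g = (\<lambda>x\<in>X. min (2 ^ T - 1) (nat \<lfloor>2 ^ T * f x\<rfloor>))"
  have mono: "f x \<le> f x'" if "x \<in> X" "x' \<in> X" "(x, x') \<in> r" for x x'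
    using f that by (auto simp: isotonic_functions_def monotone_on_def)
  have f01: "f x \<in> {0..1}" if "x \<in> X" for x
    using f that by (auto simp: isotonic_functions_def)
  have "g \<in> refinements X r T (\<lambda>x\<in>X. 0)"
  proof -
    have "g x div 2 ^ T = 0" if "x \<in> X" for x
    proof -
      have "g x \<le> 2 ^ T - 1"
        using that by (simp add: g_def)
      then have "g x < 2 ^ T"
        by (metis le_imp_less_Suc Suc_diff_1 pos2 zero_less_power)
      then show ?thesis by simp
    qed
    moreover have "g x \<le> g x'" if "x \<in> X" "x' \<in> X" "(x, x') \<in> r" for x x'
    proof -
      have "nat \<lfloor>2 ^ T * f x\<rfloor> \<le> nat \<lfloor>2 ^ T * f x'\<rfloor>"
        using mono[OF that] by (intro nat_mono floor_mono mult_left_mono) auto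
      then show ?thesis
        using that by (simp add: g_def min.coboundedI2)
    qed
    ultimately show ?thesis
      by (auto simp: refinements_def monotone_on_def g_def)
  qed
  then have "best_loss X r \<l> T D T (\<lambda>x\<in>X. 0) \<le> grid_loss \<l> T D g"
    unfolding best_loss_def using finite_refinements[OF X] by (intro Min_le) auto
  also have "\<dots> \<le> (\<Sum>i<n. \<l> (f (fst (D ! i))) (snd (D ! i)) + L / 2 ^ T)"
  proof -
    have "\<l> (real (g x) / 2 ^ T) y \<le> \<l> (f x) y + L / 2 ^ T" if x: "x \<in> X" and y: "y \<in> {0..1}" for x y
    proof -
      have "\<bar>real (g x) - 2 ^ T * f x\<bar> \<le> 1 \<and> real (g x) \<le> 2 ^ T"
        if le_T: "2 ^ T * f x \<le> 2 ^ T"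
      proof (cases "nat \<lfloor>2 ^ T * f x\<rfloor> \<le> 2 ^ T - 1")
        case True
        then have gx: "g x = nat \<lfloor>2 ^ T * f x\<rfloor>"
          using x by (simp add: g_def)
        then have "real (g x) = of_int \<lfloor>2 ^ T * f x\<rfloor>"
          using f01[OF x] by (simp add: of_nat_nat)
        then show ?thesis
          using le_T by linarith
      next
        \<comment> \<open>The cap binds only if \<open>f x = 1\<close>, and the error is then
          exactly one grid step.\<close>
        case False
        then have gx: "g x = 2 ^ T - 1"
          using x by (simp add: g_def)
        then have gx': "real (g x) = 2 ^ T - 1"
          by (simp add: of_nat_diff)
        have "2 ^ T \<le> nat \<lfloor>2 ^ T * f x\<rfloor>"
          using False by linarith
        then have "int (2 ^ T) \<le> \<lfloor>2 ^ T * f x\<rfloor>"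
          using f01[OF x] by (subst (asm) le_nat_iff) auto
        then have "2 ^ T \<le> 2 ^ T * f x"
          by (simp add: le_floor_iff)
        then show ?thesis
          unfolding gx' using le_T by auto
      qed
      moreover have "2 ^ T * f x \<le> 2 ^ T"
        using f01[OF x] by simp
      ultimately have close: "\<bar>real (g x) / 2 ^ T - f x\<bar> \<le> 1 / 2 ^ T" and "real (g x) / 2 ^ T \<in> {0..1}"
        by (auto simp: abs_le_iff field_simps)
      then have "\<bar>\<l> (real (g x) / 2 ^ T) y - \<l> (f x) y\<bar> \<le> L * \<bar>real (g x) / 2 ^ T - f x\<bar>"
        using f01[OF x] by (intro lipschitz_lossD[OF \<l> y])
      also have "\<dots> \<le> L * (1 / 2 ^ T)"
        using close by (intro mult_left_mono lipschitz_loss_nonneg[OF \<l>])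
      finally show ?thesis by simp
    qed
    then show ?thesis
      unfolding grid_loss_def length_datasets[OF D] using datasets_nth[OF D]
      by (intro sum_mono) simp
  qed
  also have "\<dots> = (\<Sum>i<n. \<l> (f (fst (D ! i))) (snd (D ! i))) + real n * L / 2 ^ T"
    by (simp add: sum.distrib)
  finally show ?thesis .
qed

section \<open>The mechanism on isotonic functions\<close>

text \<open>The default 0 makes every value isotonic, so the map is measurable from the whole
  discrete space of states.\<close>

definition grid_function :: "'a set \<Rightarrow> 'a rel \<Rightarrow> nat \<Rightarrow> ('a \<Rightarrow> nat) \<Rightarrow> 'a \<Rightarrow> real" where
  "grid_function X r T g =
     (if g \<in> refinements X r T (\<lambda>x\<in>X. 0) then (\<lambda>x\<in>X. real (g x) / 2 ^ T)
      else (\<lambda>x\<in>X. 0))"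

lemma grid_function_isotonic: "grid_function X r T g \<in> isotonic_functions X r"
proof (cases "g \<in> refinements X r T (\<lambda>x\<in>X. 0)")
  case True
  have "real (g x) \<le> 2 ^ T" if "x \<in> X" for x
    using refinements_zero_less[OF True that] by (simp add: order_less_imp_le)
  moreover have "real (g x) \<le> real (g x')" if "x \<in> X" "x' \<in> X" "(x, x') \<in> r" for x x'
    using monotone_refinements[OF True] that by (simp add: monotone_on_def)
  ultimately show ?thesis
    using True
    by (auto simp: grid_function_def isotonic_functions_def monotone_on_def divide_right_mono)
qed (auto simp: grid_function_def isotonic_functions_def monotone_on_def)

lemma space_isotonic_space: "space (isotonic_space X r) = isotonic_functions X r"
  by (auto simp: isotonic_space_def space_restrict_space isotonic_functions_def space_PiM PiE_iff
      extensional_def)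

text \<open>For \<open>L = 0\<close> the division by zero gives the inverse temperature \<open>0\<close>, hence a random walk that
  ignores the data; this is harmless because the loss is then constant in the prediction.\<close>

definition dyadic_mechanism ::
    "'a set \<Rightarrow> 'a rel \<Rightarrow> real \<Rightarrow> (real \<Rightarrow> real \<Rightarrow> real) \<Rightarrow> real \<Rightarrow> ('a \<times> real) list
      \<Rightarrow> ('a \<Rightarrow> real) measure" where
  "dyadic_mechanism X r L \<l> \<epsilon> D =
     (let T = nat \<lceil>log 2 (\<epsilon> * real (length D))\<rceil>
      in distr (measure_pmf (descent X r \<l> T (\<epsilon> / (4 * L * (real T + 1))) D T))
           (isotonic_space X r) (grid_function X r T))"

lemma grid_function_measurable:
  "grid_function X r T \<in> measure_pmf p \<rightarrow>\<^sub>M isotonic_space X r"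
  by (auto simp: space_isotonic_space grid_function_isotonic)

lemma dyadic_mechanism_prob: "dyadic_mechanism X r L \<l> \<epsilon> D \<in> space (prob_algebra (isotonic_space X r))"
  unfolding dyadic_mechanism_def Let_def space_prob_algebra
  using measure_pmf.prob_space_distr[OF grid_function_measurable] by auto

lemma dyadic_mechanism_DP:
  assumes X: "finite X" and \<l>: "lipschitz_loss L \<l>" and "0 \<le> \<epsilon>"
  shows "isotonic_DP X r n \<epsilon> 0 (dyadic_mechanism X r L \<l> \<epsilon>)"
  unfolding isotonic_DP_def
proof (intro ballI impI)
  fix D D' S
  assume D: "D \<in> datasets X n" "D' \<in> datasets X n" "neighboring D D'"
    and S: "S \<in> sets (isotonic_space X r)"
  \<comment> \<open>Depth and temperature depend on the data only through \<open>n\<close>, so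
    \<open>D\<close> and \<open>D'\<close> share them.\<close>
  define T where "T = nat \<lceil>log 2 (\<epsilon> * real n)\<rceil>"
  define c where "c = \<epsilon> / (4 * L * (real T + 1))"
  have L: "0 \<le> L"
    by (rule lipschitz_loss_nonneg[OF \<l>])
  have c: "0 \<le> c"
    using \<open>0 \<le> \<epsilon>\<close> L by (simp add: c_def)
  \<comment> \<open>The \<open>+ 1\<close> in \<open>c\<close> avoids a zero denominator at
    \<open>T = 0\<close>; the rounds then spend slightly less than the budget.\<close>
  have "4 * c * L * real T \<le> \<epsilon>"
  proof (cases "L = 0")
    case False
    then have "4 * c * L * real T = \<epsilon> * (real T / (real T + 1))"
      by (simp add: c_def)
    also have "\<dots> \<le> \<epsilon> * 1"
      using \<open>0 \<le> \<epsilon>\<close> by (intro mult_left_mono) auto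
    finally show ?thesis by simp
  qed (use \<open>0 \<le> \<epsilon>\<close> in simp)
  then have "pmf (descent X r \<l> T c D T) k \<le> exp \<epsilon> * pmf (descent X r \<l> T c D' T) k" for k
    using pmf_descent_le[OF X \<l> c D order_refl, of r T k]
    by (elim order_trans) (auto intro!: mult_right_mono)
  then have "measure_pmf.prob (descent X r \<l> T c D T) A \<le>
      exp \<epsilon> * measure_pmf.prob (descent X r \<l> T c D' T) A" for A
    by (intro prob_le_of_pmf_le) auto
  then show "measure (dyadic_mechanism X r L \<l> \<epsilon> D) S \<le>
      exp \<epsilon> * measure (dyadic_mechanism X r L \<l> \<epsilon> D') S + 0"
    using S by (simp add: dyadic_mechanism_def Let_def length_datasets[OF D(1)]
        length_datasets[OF D(2)] measure_distr[OF grid_function_measurable] flip: T_def c_def)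
qed

lemma empirical_risk_grid_function:
  assumes "D \<in> datasets X n" "g \<in> refinements X r T (\<lambda>x\<in>X. 0)"
  shows "empirical_risk \<l> D (grid_function X r T g) = grid_loss \<l> T D g / real n"
  using assms(2) datasets_nth[OF assms(1)]
  by (simp add: empirical_risk_def grid_loss_def grid_function_def length_datasets[OF assms(1)])

lemma empirical_risk_lipschitz_0:
  assumes \<l>: "lipschitz_loss 0 \<l>" and D: "D \<in> datasets X n"
    and f: "f \<in> isotonic_functions X r" and g: "g \<in> isotonic_functions X r"
  shows "empirical_risk \<l> D f = empirical_risk \<l> D g"
proof -
  have "\<l> (f (fst (D ! i))) (snd (D ! i)) = \<l> (g (fst (D ! i))) (snd (D ! i))" if "i < n" for i
    using lipschitz_lossD[OF \<l> datasets_nth(2)[OF D that], of "f (fst (D ! i))" "g (fst (D ! i))"]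
      datasets_nth(1)[OF D that] f g by (auto simp: isotonic_functions_def PiE_iff)
  then show ?thesis
    by (simp add: empirical_risk_def length_datasets[OF D])
qed

text \<open>Turns the base \<open>card X + 1\<close> of the counting bound into the logarithmic
  factor of the theorem.\<close>

lemma ln_Suc_le_log:
  assumes "0 < m"
  shows "ln (real m + 1) \<le> 2 * max 1 (log 2 (real m))"
proof -
  have "ln (real m + 1) \<le> ln (2 * real m)"
    using assms by (intro ln_mono) auto
  also have "\<dots> = ln 2 * (1 + log 2 (real m))"
    using assms by (simp add: ln_mult log_def field_simps)
  also have "\<dots> \<le> 1 * (1 + log 2 (real m))"
    using assms ln_2_less_1 by (intro mult_right_mono) auto
  also have "\<dots> \<le> max 1 (log 2 (real m)) + max 1 (log 2 (real m))"
    unfolding mult_1 by (intro add_mono) auto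
  finally show ?thesis by simp
qed

text \<open>The first bound controls the rounding error, the second the cost of \<open>T\<close>
  rounds at inverse temperatures proportional to \<open>1 / (T + 1)\<close>. For
  \<open>z \<le> 1\<close> no round is run.\<close>

lemma depth_bounds:
  fixes z :: real
  assumes "0 < z"
  defines "T \<equiv> nat \<lceil>log 2 z\<rceil>"
  shows "1 / 2 ^ T \<le> 1 / z" "real T * (real T + 1) \<le> 4 * (1 + (log 2 z)\<^sup>2)"
proof -
  have "log 2 z \<le> real T"
    unfolding T_def by linarith
  then have "2 powr (log 2 z) \<le> 2 powr real T"
    by (intro powr_mono) auto
  then have "z \<le> 2 ^ T"
    using assms(1) by (simp add: powr_realpow)
  then show "1 / 2 ^ T \<le> 1 / z"
    using assms(1) by (simp add: frac_le)
  show "real T * (real T + 1) \<le> 4 * (1 + (log 2 z)\<^sup>2)"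
  proof (cases "log 2 z \<le> 0")
    case True
    then have "T = 0"
      by (simp add: T_def)
    then show ?thesis by simp
  next
    case False
    then have "real T \<le> log 2 z + 1"
      unfolding T_def by linarith
    then have "real T * (real T + 1) \<le> (log 2 z + 1) * (log 2 z + 1 + 1)"
      using False by (intro mult_mono) auto
    \<comment> \<open>With \<open>u = log 2 z\<close> the difference is
      \<open>3/2 * (u - 1)^2 + 3/2 * u^2 + 1/2\<close>.\<close>
    also have "\<dots> \<le> 4 * (1 + (log 2 z)\<^sup>2)"
      using zero_le_power2[of "log 2 z - 1"] zero_le_square[of "log 2 z"]
      unfolding power2_eq_square by (simp only: algebra_simps)
    finally show ?thesis .
  qed
qed

lemma dyadic_mechanism_risk:
  assumes X: "finite X" and po: "partial_order_on X r" and \<l>: "lipschitz_loss L \<l>" and "0 < \<epsilon>" "0 < n"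
    and D: "D \<in> datasets X n"
  shows "(\<integral>f. excess_risk X r \<l> D f \<partial>(dyadic_mechanism X r L \<l> \<epsilon> D)) \<le>
    33 * (L * real (width X r) * max 1 (log 2 (real (card X))) * (1 + (log 2 (\<epsilon> * real n))\<^sup>2) / (\<epsilon> * real n))"
proof -
  define T where "T = nat \<lceil>log 2 (\<epsilon> * real n)\<rceil>"
  define c where "c = \<epsilon> / (4 * L * (real T + 1))"
  define p where "p = descent X r \<l> T c D T"
  define f where "f = arg_min_on (empirical_risk \<l> D) (isotonic_functions X r)"
  let ?root = "\<lambda>x\<in>X. 0 :: nat"
  have f: "f \<in> isotonic_functions X r"
    using empirical_risk_has_minimizer[OF \<l> D, of r] by (simp add: f_def is_arg_min_linorder)
  have mech: "dyadic_mechanism X r L \<l> \<epsilon> D = distr (measure_pmf p) (isotonic_space X r) (grid_function X r T)"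
    by (simp add: dyadic_mechanism_def Let_def length_datasets[OF D] p_def flip: T_def c_def)
  have "integrable (dyadic_mechanism X r L \<l> \<epsilon> D) (excess_risk X r \<l> D)"
    by (rule integrable_excess_risk[OF \<l> D dyadic_mechanism_prob])
  then have meas: "excess_risk X r \<l> D \<in> borel_measurable (isotonic_space X r)"
    unfolding mech by (auto dest: borel_measurable_integrable)
  have p: "set_pmf p \<subseteq> refinements X r T ?root"
    unfolding p_def by (rule set_pmf_descent[OF X])
  have fin: "finite (set_pmf p)"
    using p finite_refinements[OF X] finite_subset by blast
  have "(\<integral>f. excess_risk X r \<l> D f \<partial>(dyadic_mechanism X r L \<l> \<epsilon> D)) =
      measure_pmf.expectation p (\<lambda>g. excess_risk X r \<l> D (grid_function X r T g))"
    unfolding mech by (rule integral_distr[OF grid_function_measurable meas])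
  also have "\<dots> = measure_pmf.expectation p (\<lambda>g. grid_loss \<l> T D g / real n - empirical_risk \<l> D f)"
    using p by (intro integral_cong_AE AE_pmfI)
      (auto simp: excess_risk_def f_def empirical_risk_grid_function[OF D])
  also have "\<dots> = measure_pmf.expectation p (grid_loss \<l> T D) / real n - empirical_risk \<l> D f"
    by (subst Bochner_Integration.integral_diff) (auto intro: integrable_measure_pmf_finite[OF fin])
  finally have risk: "(\<integral>f. excess_risk X r \<l> D f \<partial>(dyadic_mechanism X r L \<l> \<epsilon> D)) =
      measure_pmf.expectation p (grid_loss \<l> T D) / real n - empirical_risk \<l> D f" .
  have L: "0 \<le> L"
    by (rule lipschitz_loss_nonneg[OF \<l>])
  \<comment> \<open>As \<open>n > 0\<close>, a sample point exists; its singleton is an antichain,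
    so the width is at least 1.\<close>
  have "fst (D ! 0) \<in> X"
    by (rule datasets_nth(1)[OF D \<open>0 < n\<close>])
  then have cardX: "0 < card X" and "antichain_in X r {fst (D ! 0)}"
    using X by (auto simp: card_gt_0_iff antichain_in_def)
  then have w: "1 \<le> real (width X r)"
    using card_antichain_le_width[OF X] by fastforce
  let ?w = "real (width X r)" and ?m = "max 1 (log 2 (real (card X)))" and ?z = "\<epsilon> * real n"
  have z: "0 < ?z"
    using \<open>0 < \<epsilon>\<close> \<open>0 < n\<close> by simp
  show ?thesis
  proof (cases "L = 0")
    case True
    have "measure_pmf.expectation p (grid_loss \<l> T D) =
        measure_pmf.expectation p (\<lambda>g. real n * empirical_risk \<l> D f)"
    proof (intro integral_cong_AE AE_pmfI)
      fix g assume "g \<in> set_pmf p"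
      then have "grid_loss \<l> T D g / real n = empirical_risk \<l> D f"
        using p empirical_risk_grid_function[OF D]
          empirical_risk_lipschitz_0[OF \<l>[unfolded True] D grid_function_isotonic f] by (metis subsetD)
      then show "grid_loss \<l> T D g = real n * empirical_risk \<l> D f"
        using \<open>0 < n\<close> by (simp add: field_simps)
    qed auto
    then show ?thesis
      unfolding risk using True \<open>0 < n\<close> by simp
  next
    case False
    then have c: "0 < c"
      using L \<open>0 < \<epsilon>\<close> by (simp add: c_def)
    \<comment> \<open>With no level left, the cost-to-go of a state is its own loss.\<close>
    have "measure_pmf.expectation p (grid_loss \<l> T D) = measure_pmf.expectation p (best_loss X r \<l> T D 0)"
    proof (intro integral_cong_AE AE_pmfI)
      fix g assume "g \<in> set_pmf p"
      then have "g \<in> refinements X r T ?root"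
        using p by blast
      then have "refinements X r 0 g = {g}"
        by (intro refinements_0) (auto simp: refinements_def)
      then show "grid_loss \<l> T D g = best_loss X r \<l> T D 0 g"
        by (simp add: best_loss_def)
    qed auto
    also have "\<dots> \<le> best_loss X r \<l> T D T ?root + real T * (?w * ln (real (card X) + 1) / c)"
      using expectation_descent_le[OF X po c order_refl, of \<l> T D] by (simp add: p_def)
    also have "best_loss X r \<l> T D T ?root \<le> real n * empirical_risk \<l> D f + real n * L / 2 ^ T"
      using best_loss_root_le[OF X \<l> D f, of T] \<open>0 < n\<close>
      by (simp add: empirical_risk_def length_datasets[OF D])
    finally have "measure_pmf.expectation p (grid_loss \<l> T D) / real n \<le>
        (real n * empirical_risk \<l> D f + real n * L / 2 ^ T
          + real T * (?w * ln (real (card X) + 1) / c)) / real n"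
      using \<open>0 < n\<close> by (intro divide_right_mono) auto
    \<comment> \<open>Since \<open>1 / c = 4 * L * (T + 1) / \<epsilon>\<close>, the
      \<open>T\<close> rounds produce the product \<open>T * (T + 1)\<close>.\<close>
    also have "\<dots> = empirical_risk \<l> D f + L * (1 / 2 ^ T)
        + 4 * L * ?w * (real T * (real T + 1)) * ln (real (card X) + 1) / ?z"
      using \<open>0 < n\<close> \<open>0 < \<epsilon>\<close> False by (simp add: c_def field_simps)
    finally have "measure_pmf.expectation p (grid_loss \<l> T D) / real n - empirical_risk \<l> D f \<le>
        L * (1 / 2 ^ T) + 4 * L * ?w * (real T * (real T + 1)) * ln (real (card X) + 1) / ?z"
      by simp
    also have "L * (1 / 2 ^ T) \<le> L * (?w * ?m * (1 + (log 2 ?z)\<^sup>2) / ?z)"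
    proof (intro mult_left_mono L)
      have "1 * 1 * 1 \<le> ?w * ?m * (1 + (log 2 ?z)\<^sup>2)"
        using w by (intro mult_mono) auto
      then have "1 / ?z \<le> ?w * ?m * (1 + (log 2 ?z)\<^sup>2) / ?z"
        using z by (intro divide_right_mono) auto
      then show "1 / 2 ^ T \<le> ?w * ?m * (1 + (log 2 ?z)\<^sup>2) / ?z"
        using depth_bounds(1)[OF z] unfolding T_def by linarith
    qed
    also have "4 * L * ?w * (real T * (real T + 1)) * ln (real (card X) + 1) / ?z \<le>
        4 * L * ?w * (4 * (1 + (log 2 ?z)\<^sup>2)) * (2 * ?m) / ?z"
      using z L ln_Suc_le_log[OF cardX]
      by (intro divide_right_mono mult_mono[OF mult_left_mono] depth_bounds(2)[OF z, folded T_def]) auto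
    \<comment> \<open>\<open>33 = 1 + 4 * 4 * 2\<close>: rounding gives 1; the descent gives 4 from
      \<open>c\<close>, 4 from the depth and 2 from the logarithm.\<close>
    also have "L * (?w * ?m * (1 + (log 2 ?z)\<^sup>2) / ?z) + 4 * L * ?w * (4 * (1 + (log 2 ?z)\<^sup>2)) * (2 * ?m) / ?z
        = 33 * (L * ?w * ?m * (1 + (log 2 ?z)\<^sup>2) / ?z)"
      by (simp only: divide_inverse) algebra
    finally show ?thesis
      unfolding risk by simp
  qed
qed

theorem theorem1:
  shows "\<exists>C>0. \<forall>(X :: 'a set) r L \<l> \<epsilon>.
           finite X \<longrightarrow> partial_order_on X r \<longrightarrow> lipschitz_loss L \<l> \<longrightarrow> 0 < \<epsilon> \<longrightarrow> \<epsilon> \<le> 1 \<longrightarrow>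
           (\<exists>M. \<forall>n>0.
              isotonic_algorithm X r n M \<and>
              isotonic_DP X r n \<epsilon> 0 M \<and>
              (\<forall>D\<in>datasets X n.
                 (\<integral>f. excess_risk X r \<l> D f \<partial>(M D))
                 \<le> C * (L * real (width X r) * max 1 (log 2 (real (card X)))
                          * (1 + (log 2 (\<epsilon> * real n))\<^sup>2) / (\<epsilon> * real n))))"
proof (intro exI[of _ "33::real"] conjI allI impI)
  fix X :: "'a set" and r L \<l> and \<epsilon> :: real
  assume *: "finite X" "partial_order_on X r" "lipschitz_loss L \<l>" "0 < \<epsilon>" "\<epsilon> \<le> 1"
  show "\<exists>M. \<forall>n>0. isotonic_algorithm X r n M \<and> isotonic_DP X r n \<epsilon> 0 M \<and>
      (\<forall>D\<in>datasets X n. (\<integral>f. excess_risk X r \<l> D f \<partial>(M D))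
        \<le> 33 * (L * real (width X r) * max 1 (log 2 (real (card X)))
                 * (1 + (log 2 (\<epsilon> * real n))\<^sup>2) / (\<epsilon> * real n)))"
    using dyadic_mechanism_prob dyadic_mechanism_DP[OF *(1,3) less_imp_le[OF *(4)]]
      dyadic_mechanism_risk[OF *(1-4)]
    \<comment> \<open>One witness serves all \<open>n\<close>, because the mechanism reads the
      sample size off the length of its input.\<close>
    by (intro exI[of _ "dyadic_mechanism X r L \<l> \<epsilon>"] allI impI conjI ballI)
      (auto simp: isotonic_algorithm_def)
qed simp

end
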